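(* Let $q>3$ be a prime power. (a) The ideal $$\mathcal{I}_q:=\langle F_{a,b}\colon a,b\in\mathbb{F}_q,\ a\neq b\rangle+\langle x_i^q-x_i\colon i\in\{0,\ldots,q-2\}\rangle\subset\mathbb{F}_q[X_q]$$ is zero-dimensional and radical, and $\mathcal{P}_q$ is identified with its algebraic set $\mathcal{Z}(\mathcal{I}_q)$, via the bijection $(s_0,\ldots,s_{q-2})\mapsto\sum_{i=0}^{q-2}s_ix^i$ from $\mathcal{Z}(\mathcal{I}_q)$ onto $\mathcal{P}_q$. As a consequence, $|\mathcal{P}_q|=|\mathcal{Z}(\mathcal{I}_q)|=\dim_{\mathbb{F}_q}(\mathbb{F}_q[X_q]/\mathcal{I}_q)$. (b) The ideal $$\mathcal{J}_q:=\langle G^{\mathrm{row}}_{a,b,c},\,G^{\mathrm{col}}_{a,b,c}\colon a,b,c\in\mathbb{F}_q,\ a\neq b\rangle+\langle x_{ij}^q-x_{ij}\colon i,j\in\{0,\ldots,q-2\}\rangle\subset\mathbb{F}_q[\overline{X}_q]$$ is zero-dimensional and radical, and $\mathcal{LP}_q$ is identified with its algebraic set $\mathcal{Z}(\mathcal{J}_q)$, via the bijection $(s_{ij})_{0\le i,j\le q-2}\mapsto\sum_{i,j=0}^{q-2}s_{ij}x^iy^j$ from $\mathcal{Z}(\mathcal{J}_q)$ onto $\mathcal{LP}_q$. As a consequence, $|\mathcal{LP}_q|=|\mathcal{Z}(\mathcal{J}_q)|=\dim_{\mathbb{F}_q}(\mathbb{F}_q[\overline{X}_q]/\mathcal{J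}_q)$.
   Context: $\mathbb{F}_q$ is the finite field with $q$ elements. $\mathcal{P}_q$ is the set of permutation polynomials: polynomials in $\mathbb{F}_q[x]$ of degree less than $q$ that act as permutations of $\mathbb{F}_q$. $\mathcal{LP}_q$ is the set of local permutation polynomials: polynomials $f\in\mathbb{F}_q[x,y]$ of degree less than $q$ in each variable such that, for every $a\in\mathbb{F}_q$, both $f(x,a)$ and $f(a,x)$ act as permutations of $\mathbb{F}_q$. $X_q:=\{x_i\colon 0\le i\le q-2\}$ and $\overline{X}_q:=\{x_{ij}\colon 0\le i,j\le q-2\}$ are sets of variables. Put $F(x):=x^{q-1}-1$ and, for $a,b,c\in\mathbb{F}_q$ with $a\ne b$ (with the convention $0^0=1$), $$F_{a,b}:=F\Big(\sum_{i=0}^{q-2}(a^i-b^i)x_i\Big)\in\mathbb{F}_q[X_q],$$ $$G^{\mathrm{row}}_{a,b,c}:=F\Big(\sum_{i,j=0}^{q-2}(a^i-b^i)c^jx_{ji}\Big),\qquad G^{\mathrm{col}}_{a,b,c}:=F\Big(\sum_{i,j=0}^{q-2}(a^i-b^i)c^jx_{ij}\Big)\in\mathbb{F}_q[\overline{X}_q].$$ For an ideal $I$ of a polynomial ring over $\mathbb{F}_q$ in $n$ variables, $\mathcal{Z}(I)$ denotes the set of points of $\mathbb{F}_q^n$ at which all elements of $I$ vanish; $I$ is zero-dimensional if the quotient ring by $I$ is a finite-dimensional $\mathbb{F}_q$-vector space. *)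

theory Defs
  imports
    "HOL-Library.Poly_Mapping"
    "HOL-Library.FuncSet"
    "HOL-Library.Cardinality"
    "HOL-Computational_Algebra.Polynomial"
    "HOL-Algebra.QuotRing"
    "HOL-Algebra.Embedded_Algebras"
begin

section \<open>Polynomial rings in a set of variables\<close>

text \<open>
  Multivariate polynomials are finitely supported maps from exponent vectors
  (finitely supported maps from variables to naturals) to coefficients; multiplication is
  the convolution product of \<^theory>\<open>HOL-Library.Poly_Mapping\<close>. The type \<open>'v\<close>
  may have more elements than there are variables; the polynomial ring in the variables of \<open>V\<close>
  is therefore the following record with explicit carrier.
\<close>

type_synonym ('v, 'a) mpoly = "('v \<Rightarrow>\<^sub>0 nat) \<Rightarrow>\<^sub>0 'a"

definition mpoly_ring :: "'v set \<Rightarrow> ('v, 'a::comm_ring_1) mpoly ring" where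
  "mpoly_ring V = \<lparr>carrier = {p. \<forall>m \<in> Poly_Mapping.keys p. Poly_Mapping.keys m \<subseteq> V},
     monoid.mult = (*), one = 1, ring.zero = 0, add = (+)\<rparr>"

definition Const :: "'a::comm_ring_1 \<Rightarrow> ('v, 'a) mpoly" where
  "Const c = Poly_Mapping.single 0 c"

definition Var :: "'v \<Rightarrow> ('v, 'a::comm_ring_1) mpoly" where
  "Var v = Poly_Mapping.single (Poly_Mapping.single v 1) 1"

definition eval_mpoly :: "('v \<Rightarrow> 'a::comm_ring_1) \<Rightarrow> ('v, 'a) mpoly \<Rightarrow> 'a" where
  "eval_mpoly s p = (\<Sum>m \<in> Poly_Mapping.keys p. Poly_Mapping.lookup p m *
     (\<Prod>v \<in> Poly_Mapping.keys m. s v ^ Poly_Mapping.lookup m v))"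

lemma cring_mpoly_ring: "cring (mpoly_ring V :: ('v, 'a::comm_ring_1) mpoly ring)"
proof -
  define C :: "('v, 'a) mpoly set" where "C = carrier (mpoly_ring V)"
  have C_iff: "p \<in> C \<longleftrightarrow> (\<forall>m \<in> Poly_Mapping.keys p. Poly_Mapping.keys m \<subseteq> V)" for p
    by (simp add: C_def mpoly_ring_def)
  have ring_eq: "mpoly_ring V = \<lparr>carrier = C, monoid.mult = (*), one = 1, ring.zero = 0, add = (+)\<rparr>"
    by (simp add: C_def mpoly_ring_def)
  have zero: "0 \<in> C" and one: "1 \<in> C"
    by (simp_all add: C_iff)
  have plus: "p + q \<in> C" if "p \<in> C" "q \<in> C" for p q
    using that Poly_Mapping.keys_add[of p q] unfolding C_iff by blast
  have uminus: "- p \<in> C" if "p \<in> C" for p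
    using that by (simp add: C_iff)
  have times: "p * q \<in> C" if p: "p \<in> C" and q: "q \<in> C" for p q
    unfolding C_iff
  proof
    fix m assume m: "m \<in> Poly_Mapping.keys (p * q)"
    obtain a b where ab: "m = a + b" "a \<in> Poly_Mapping.keys p" "b \<in> Poly_Mapping.keys q"
      using subsetD[OF Poly_Mapping.keys_mult m] by blast
    have "Poly_Mapping.keys a \<subseteq> V" "Poly_Mapping.keys b \<subseteq> V"
      using p q ab unfolding C_iff by blast+
    then show "Poly_Mapping.keys m \<subseteq> V"
      using Poly_Mapping.keys_add[of a b] ab(1) by blast
  qed
  show ?thesis
    unfolding ring_eq
  proof (rule cringI, goal_cases)
    case 1
    show ?case
      by (rule abelian_groupI)
        (auto simp: plus zero add.assoc add.commute intro: bexI[OF _ uminus])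
  next
    case 2
    show ?case
      by (rule comm_monoidI) (auto simp: times one mult.assoc mult.commute)
  next
    case (3 x y z)
    show ?case by (simp add: distrib_right)
  qed
qed


section \<open>Zero sets, radical ideals, dimension of the quotient\<close>

text \<open>Points of affine space over the variables \<open>V\<close> are functions that are fixed outside \<open>V\<close>
  (extensional functions), so that a point is determined by its coordinates in \<open>V\<close>.\<close>

definition zero_set :: "'v set \<Rightarrow> ('v, 'a::comm_ring_1) mpoly set \<Rightarrow> ('v \<Rightarrow> 'a) set" where
  "zero_set V I = {s \<in> V \<rightarrow>\<^sub>E UNIV. \<forall>p \<in> I. eval_mpoly s p = 0}"

definition ideal_radical :: "('r, 'm) ring_scheme \<Rightarrow> 'r set \<Rightarrow> 'r set" where
  "ideal_radical R I = {p \<in> carrier R. \<exists>n::nat. n > 0 \<and> p [^]\<^bsub>R\<^esub> n \<in> I}"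

definition radical_ideal :: "'r set \<Rightarrow> ('r, 'm) ring_scheme \<Rightarrow> bool" where
  "radical_ideal I R \<longleftrightarrow> ideal I R \<and> ideal_radical R I = I"

text \<open>The vector space structure on a quotient of the polynomial ring is multiplication by the
  residue classes of the constants.\<close>

definition quot_scalars :: "'v set \<Rightarrow> ('v, 'a::field) mpoly set \<Rightarrow> ('v, 'a) mpoly set set" where
  "quot_scalars V I = (\<lambda>c. I +>\<^bsub>mpoly_ring V\<^esub> Const c) ` UNIV"

definition zero_dimensional :: "'v set \<Rightarrow> ('v, 'a::field) mpoly set \<Rightarrow> bool" where
  "zero_dimensional V I \<longleftrightarrow> ideal I (mpoly_ring V) \<and>
     ring.finite_dimension (mpoly_ring V Quot I) (quot_scalars V I)
       (carrier (mpoly_ring V Quot I))"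

definition quot_dim :: "'v set \<Rightarrow> ('v, 'a::field) mpoly set \<Rightarrow> nat" where
  "quot_dim V I = ring.dim (mpoly_ring V Quot I) (quot_scalars V I)
     (carrier (mpoly_ring V Quot I))"


section \<open>Permutation polynomials and local permutation polynomials\<close>

text \<open>The field with \<open>q\<close> elements is the type \<open>'a\<close>, and \<open>q\<close> is \<open>CARD('a)\<close>.\<close>

definition perm_polys :: "'a::{field, finite} poly set" where
  "perm_polys = {f. Polynomial.degree f < CARD('a) \<and> bij (poly f)}"

text \<open>Bivariate polynomials have type \<open>'a poly poly\<close>: the outer variable is \<open>y\<close>, and the
  coefficients are polynomials in \<open>x\<close>.\<close>

definition eval2 :: "'a::comm_ring_1 poly poly \<Rightarrow> 'a \<Rightarrow> 'a \<Rightarrow> 'a" where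
  "eval2 f x y = poly (poly f [:y:]) x"

definition local_perm_polys :: "'a::{field, finite} poly poly set" where
  "local_perm_polys = {f.
     (\<forall>j. Polynomial.degree (Polynomial.coeff f j) < CARD('a)) \<and>
     Polynomial.degree f < CARD('a) \<and>
     (\<forall>a. bij (\<lambda>x. eval2 f x a) \<and> bij (\<lambda>x. eval2 f a x))}"


section \<open>The two ideals\<close>

definition X_vars :: "'a::{field, finite} itself \<Rightarrow> nat set" where
  "X_vars _ = {0..CARD('a) - 2}"

definition XX_vars :: "'a::{field, finite} itself \<Rightarrow> (nat \<times> nat) set" where
  "XX_vars _ = {0..CARD('a) - 2} \<times> {0..CARD('a) - 2}"

text \<open>The polynomial \<open>x ^ (q - 1) - 1\<close>, evaluated at an element of a polynomial ring over the
  field with \<open>q\<close> elements.\<close>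

definition F :: "('v, 'a::{field, finite}) mpoly \<Rightarrow> ('v, 'a) mpoly" where
  "F p = p ^ (CARD('a) - 1) - 1"

definition F_gen :: "'a::{field, finite} \<Rightarrow> 'a \<Rightarrow> (nat, 'a) mpoly" where
  "F_gen a b = F (\<Sum>i = 0..CARD('a) - 2. Const (a ^ i - b ^ i) * Var i)"

definition G_row :: "'a::{field, finite} \<Rightarrow> 'a \<Rightarrow> 'a \<Rightarrow> (nat \<times> nat, 'a) mpoly" where
  "G_row a b c = F (\<Sum>i = 0..CARD('a) - 2. \<Sum>j = 0..CARD('a) - 2.
     Const ((a ^ i - b ^ i) * c ^ j) * Var (j, i))"

definition G_col :: "'a::{field, finite} \<Rightarrow> 'a \<Rightarrow> 'a \<Rightarrow> (nat \<times> nat, 'a) mpoly" where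
  "G_col a b c = F (\<Sum>i = 0..CARD('a) - 2. \<Sum>j = 0..CARD('a) - 2.
     Const ((a ^ i - b ^ i) * c ^ j) * Var (i, j))"

definition I_ideal :: "(nat, 'a::{field, finite}) mpoly set" where
  "I_ideal = (let R = mpoly_ring (X_vars TYPE('a)) in
     Idl\<^bsub>R\<^esub> {F_gen a b | a b. a \<noteq> b} <+>\<^bsub>R\<^esub>
     Idl\<^bsub>R\<^esub> {Var i ^ CARD('a) - Var i | i. i \<in> X_vars TYPE('a)})"

definition J_ideal :: "(nat \<times> nat, 'a::{field, finite}) mpoly set" where
  "J_ideal = (let R = mpoly_ring (XX_vars TYPE('a)) in
     Idl\<^bsub>R\<^esub> ({G_row a b c | a b c. a \<noteq> b} \<union> {G_col a b c | a b c. a \<noteq> b}) <+>\<^bsub>R\<^esub>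
     Idl\<^bsub>R\<^esub> {Var v ^ CARD('a) - Var v | v. v \<in> XX_vars TYPE('a)})"

definition poly_of_point :: "(nat \<Rightarrow> 'a::{field, finite}) \<Rightarrow> 'a poly" where
  "poly_of_point s = (\<Sum>i = 0..CARD('a) - 2. Polynomial.monom (s i) i)"

definition poly2_of_point :: "(nat \<times> nat \<Rightarrow> 'a::{field, finite}) \<Rightarrow> 'a poly poly" where
  "poly2_of_point s = (\<Sum>i = 0..CARD('a) - 2. \<Sum>j = 0..CARD('a) - 2.
     Polynomial.monom (Polynomial.monom (s (i, j)) i) j)"

end

theory Submission
  imports Defs
begin

text \<open>
  Let \<open>I\<close> be an ideal containing all field equations \<open>x ^ q - x\<close>, and let \<open>\<delta>\<close> be the product over
  the variables \<open>x\<close> of the Lagrange polynomials in \<open>x\<close> that single out the coordinates of a point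
  \<open>s\<close>. Modulo \<open>I\<close> every polynomial \<open>p\<close> satisfies \<open>p \<delta> = p(s) \<delta>\<close>, and the sum of these
  \<open>\<delta>\<close> over all points is 1. Hence \<open>\<delta>\<close> lies in \<open>I\<close> if \<open>s\<close> is not a zero of \<open>I\<close>, so \<open>I\<close> consists of
  all polynomials vanishing on its zero set; it is radical, and the classes of the remaining \<open>\<delta>\<close> form a
  basis of the quotient. Since \<open>F(t) = 0\<close> exactly for \<open>t \<noteq> 0\<close>, the zeros of the two ideals are the
  coefficient vectors of (local) permutation polynomials of degree at most \<open>q - 2\<close> in each variable,
  and the degree bound holds for every (local) permutation polynomial because its coefficient of
  degree \<open>q - 1\<close> is a multiple of the sum of all field elements.
\<close>

section \<open>Evaluation of multivariate polynomials\<close>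

lemma prod_keys_superset:
  fixes s :: "'v \<Rightarrow> 'a::comm_monoid_mult"
  assumes "finite A" "Poly_Mapping.keys m \<subseteq> A"
  shows "(\<Prod>v\<in>Poly_Mapping.keys m. s v ^ Poly_Mapping.lookup m v) =
    (\<Prod>v\<in>A. s v ^ Poly_Mapping.lookup m v)"
  using assms by (intro prod.mono_neutral_left) (auto simp: in_keys_iff)

lemma prod_keys_add:
  fixes s :: "'v \<Rightarrow> 'a::comm_monoid_mult"
  shows "(\<Prod>v\<in>Poly_Mapping.keys (m + n). s v ^ Poly_Mapping.lookup (m + n) v) =
    (\<Prod>v\<in>Poly_Mapping.keys m. s v ^ Poly_Mapping.lookup m v) *
    (\<Prod>v\<in>Poly_Mapping.keys n. s v ^ Poly_Mapping.lookup n v)"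
proof -
  let ?A = "Poly_Mapping.keys m \<union> Poly_Mapping.keys n"
  have "Poly_Mapping.keys (m + n) \<subseteq> ?A"
    by (rule Poly_Mapping.keys_add)
  then show ?thesis
    by (subst (1 2 3) prod_keys_superset[where A = ?A])
      (auto simp: lookup_add power_add prod.distrib)
qed

lemma sum_singles:
  "(\<Sum>m\<in>Poly_Mapping.keys p. Poly_Mapping.single m (Poly_Mapping.lookup p m)) = p"
  by (rule poly_mapping_eqI)
    (simp add: lookup_sum lookup_single when_def in_keys_iff)

lemma eval_mpoly_superset:
  assumes "finite A" "Poly_Mapping.keys p \<subseteq> A"
  shows "eval_mpoly s p = (\<Sum>m\<in>A. Poly_Mapping.lookup p m *
     (\<Prod>v\<in>Poly_Mapping.keys m. s v ^ Poly_Mapping.lookup m v))"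
  unfolding eval_mpoly_def using assms
  by (intro sum.mono_neutral_left) (auto simp: in_keys_iff)

lemma eval_mpoly_add [simp]: "eval_mpoly s (p + q) = eval_mpoly s p + eval_mpoly s q"
proof -
  let ?A = "Poly_Mapping.keys p \<union> Poly_Mapping.keys q"
  have "Poly_Mapping.keys (p + q) \<subseteq> ?A"
    by (rule Poly_Mapping.keys_add)
  then show ?thesis
    by (subst (1 2 3) eval_mpoly_superset[where A = ?A])
      (auto simp: lookup_add distrib_right sum.distrib)
qed

lemma eval_mpoly_zero [simp]: "eval_mpoly s 0 = 0"
  by (simp add: eval_mpoly_def)

lemma eval_mpoly_diff [simp]: "eval_mpoly s (p - q) = eval_mpoly s p - eval_mpoly s q"
  using eval_mpoly_add[of s "p - q" q] by (simp add: algebra_simps del: eval_mpoly_add)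

lemma eval_mpoly_sum [simp]: "eval_mpoly s (\<Sum>i\<in>A. f i) = (\<Sum>i\<in>A. eval_mpoly s (f i))"
  by (induction A rule: infinite_finite_induct) simp_all

lemma eval_mpoly_single:
  "eval_mpoly s (Poly_Mapping.single m c) =
    c * (\<Prod>v\<in>Poly_Mapping.keys m. s v ^ Poly_Mapping.lookup m v)"
  by (simp add: eval_mpoly_def)

lemma eval_mpoly_Const [simp]: "eval_mpoly s (Const c) = c"
  by (simp add: Const_def eval_mpoly_single)

lemma eval_mpoly_Var [simp]: "eval_mpoly s (Var v) = s v"
  by (simp add: Var_def eval_mpoly_single)

lemma eval_mpoly_one [simp]: "eval_mpoly s 1 = 1"
  using eval_mpoly_Const[of s 1] by (simp add: Const_def)

lemma eval_mpoly_mult [simp]: "eval_mpoly s (p * q) = eval_mpoly s p * eval_mpoly s q"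
proof -
  have "p * q = (\<Sum>m\<in>Poly_Mapping.keys p. \<Sum>n\<in>Poly_Mapping.keys q.
      Poly_Mapping.single (m + n) (Poly_Mapping.lookup p m * Poly_Mapping.lookup q n))"
    by (subst (1) sum_singles[of p, symmetric], subst (1) sum_singles[of q, symmetric])
      (simp add: sum_product mult_single)
  then show ?thesis
    by (simp add: eval_mpoly_single prod_keys_add eval_mpoly_def[of s p] eval_mpoly_def[of s q]
        sum_product mult.assoc mult.left_commute)
qed

lemma eval_mpoly_power [simp]: "eval_mpoly s (p ^ n) = eval_mpoly s p ^ n"
  by (induction n) simp_all

lemma eval_mpoly_prod [simp]: "eval_mpoly s (\<Prod>i\<in>A. f i) = (\<Prod>i\<in>A. eval_mpoly s (f i))"
  by (induction A rule: infinite_finite_induct) simp_all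

lemma Const_add: "Const (a + b) = Const a + Const b"
  by (simp add: Const_def single_add)

lemma Const_mult: "Const (a * b) = Const a * Const b"
  by (simp add: Const_def mult_single)

lemma Const_0 [simp]: "Const 0 = 0"
  by (simp add: Const_def)

lemma Const_1 [simp]: "Const 1 = 1"
  by (simp add: Const_def)

lemma Const_uminus: "Const (- a) = - Const a"
  using Const_add[of a "- a"] by (simp add: eq_neg_iff_add_eq_0 add.commute)

lemma Var_power: "Var v ^ n = Poly_Mapping.single (Poly_Mapping.single v n) 1"
  by (induction n) (simp_all add: Var_def mult_single single_add[symmetric])

lemma single_eq_Const_mult_Vars:
  "Poly_Mapping.single m c =
    Const c * (\<Prod>v\<in>Poly_Mapping.keys m. Var v ^ Poly_Mapping.lookup m v)"
proof -
  have "(\<Prod>v\<in>A. Poly_Mapping.single (f v) 1) =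
    Poly_Mapping.single (\<Sum>v\<in>A. f v) (1 :: 'b)" for f :: "'a \<Rightarrow> 'a \<Rightarrow>\<^sub>0 nat" and A
    by (induction A rule: infinite_finite_induct) (simp_all add: mult_single)
  then show ?thesis
    by (simp add: Var_power sum_singles Const_def mult_single)
qed

section \<open>The polynomial ring over a set of variables: closure properties and induction\<close>

lemma mpoly_ring_sel [simp]:
  "(\<otimes>\<^bsub>mpoly_ring V\<^esub>) = (*)" "\<one>\<^bsub>mpoly_ring V\<^esub> = 1"
  "(\<oplus>\<^bsub>mpoly_ring V\<^esub>) = (+)" "\<zero>\<^bsub>mpoly_ring V\<^esub> = 0"
  by (simp_all add: mpoly_ring_def)

lemma Const_in_carrier [simp]: "Const c \<in> carrier (mpoly_ring V)"
  by (simp add: mpoly_ring_def Const_def)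

lemma Var_in_carrier [simp]: "v \<in> V \<Longrightarrow> Var v \<in> carrier (mpoly_ring V)"
  by (simp add: mpoly_ring_def Var_def)

lemma mpoly_carrier_add [simp]:
  "p \<in> carrier (mpoly_ring V) \<Longrightarrow> q \<in> carrier (mpoly_ring V) \<Longrightarrow> p + q \<in> carrier (mpoly_ring V)"
  using cring.cring_simprules(1)[OF cring_mpoly_ring, of p V q] by simp

lemma mpoly_carrier_mult [simp]:
  "p \<in> carrier (mpoly_ring V) \<Longrightarrow> q \<in> carrier (mpoly_ring V) \<Longrightarrow> p * q \<in> carrier (mpoly_ring V)"
  using cring.cring_simprules(5)[OF cring_mpoly_ring, of p V q] by simp

lemma mpoly_carrier_zero_one [simp]:
  "0 \<in> carrier (mpoly_ring V)" "1 \<in> carrier (mpoly_ring V)"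
  by (simp_all add: mpoly_ring_def)

lemma mpoly_carrier_uminus [simp]:
  "p \<in> carrier (mpoly_ring V) \<Longrightarrow> - p \<in> carrier (mpoly_ring V)"
  by (simp add: mpoly_ring_def)

lemma mpoly_carrier_diff [simp]:
  "p \<in> carrier (mpoly_ring V) \<Longrightarrow> q \<in> carrier (mpoly_ring V) \<Longrightarrow> p - q \<in> carrier (mpoly_ring V)"
  using mpoly_carrier_add[of p V "- q"] by simp

lemma mpoly_carrier_power [simp]:
  "p \<in> carrier (mpoly_ring V) \<Longrightarrow> p ^ n \<in> carrier (mpoly_ring V)"
  by (induction n) simp_all

lemma mpoly_carrier_sum [simp]:
  "(\<And>i. i \<in> A \<Longrightarrow> f i \<in> carrier (mpoly_ring V)) \<Longrightarrow> (\<Sum>i\<in>A. f i) \<in> carrier (mpoly_ring V)"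
  by (induction A rule: infinite_finite_induct) simp_all

lemma mpoly_carrier_prod [simp]:
  "(\<And>i. i \<in> A \<Longrightarrow> f i \<in> carrier (mpoly_ring V)) \<Longrightarrow> (\<Prod>i\<in>A. f i) \<in> carrier (mpoly_ring V)"
  by (induction A rule: infinite_finite_induct) simp_all

lemma mpoly_pow [simp]: "p [^]\<^bsub>mpoly_ring V\<^esub> (n::nat) = p ^ n"
  by (induction n) (simp_all add: nat_pow_def mpoly_ring_def mult.commute)

text \<open>A polynomial is the sum of its monomials, each a constant times powers of variables from
  \<open>V\<close>. The carrier assumptions in the cases \<open>add\<close> and \<open>mult\<close>
  allow absorption into an ideal during the induction.\<close>

lemma mpoly_induct [consumes 1, case_names Const Var add mult]:
  fixes p :: "('v, 'a::comm_ring_1) mpoly"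
  assumes "p \<in> carrier (mpoly_ring V)"
    and const: "\<And>c. P (Const c)"
    and var: "\<And>v. v \<in> V \<Longrightarrow> P (Var v)"
    and add: "\<And>p q. p \<in> carrier (mpoly_ring V) \<Longrightarrow> q \<in> carrier (mpoly_ring V) \<Longrightarrow>
      P p \<Longrightarrow> P q \<Longrightarrow> P (p + q)"
    and mult: "\<And>p q. p \<in> carrier (mpoly_ring V) \<Longrightarrow> q \<in> carrier (mpoly_ring V) \<Longrightarrow>
      P p \<Longrightarrow> P q \<Longrightarrow> P (p * q)"
  shows "P p"
proof -
  let ?C = "carrier (mpoly_ring V)"
  have zero: "P 0" and one: "P 1"
    using const[of 0] const[of 1] by simp_all
  have power: "P (Var v ^ n)" if "v \<in> V" for v n
    by (induction n) (use that one in \<open>auto intro: mult var\<close>)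
  have vars: "(\<Prod>v\<in>A. Var v ^ f v) \<in> ?C \<and> P (\<Prod>v\<in>A. Var v ^ f v)" if "A \<subseteq> V" for A f
    using that
    by (induction A rule: infinite_finite_induct) (auto simp: one intro!: mult power mpoly_carrier_power mpoly_carrier_prod)
  have sums: "(\<Sum>i\<in>A. f i) \<in> ?C \<and> P (\<Sum>i\<in>A. f i)" if "\<forall>i\<in>A. f i \<in> ?C \<and> P (f i)"
    for A and f :: "('v \<Rightarrow>\<^sub>0 nat) \<Rightarrow> ('v, 'a) mpoly"
    using that by (induction A rule: infinite_finite_induct) (auto simp: zero intro: add)
  have "P (\<Sum>m\<in>Poly_Mapping.keys p. Const (Poly_Mapping.lookup p m) *
      (\<Prod>v\<in>Poly_Mapping.keys m. Var v ^ Poly_Mapping.lookup m v))"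
  proof (rule conjunct2[OF sums], intro ballI)
    fix m assume "m \<in> Poly_Mapping.keys p"
    then have "Poly_Mapping.keys m \<subseteq> V"
      using assms(1) by (simp add: mpoly_ring_def)
    then show "Const (Poly_Mapping.lookup p m) *
        (\<Prod>v\<in>Poly_Mapping.keys m. Var v ^ Poly_Mapping.lookup m v) \<in> ?C \<and>
      P (Const (Poly_Mapping.lookup p m) *
        (\<Prod>v\<in>Poly_Mapping.keys m. Var v ^ Poly_Mapping.lookup m v))"
      using vars by (blast intro: mult const Const_in_carrier mpoly_carrier_mult)
  qed
  then show ?thesis
    by (simp only: single_eq_Const_mult_Vars[symmetric] sum_singles)
qed

section \<open>Lagrange interpolation over a finite field\<close>

text \<open>For every \<open>c\<close> the product of \<open>c - d\<close> over all \<open>d\<close>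
  other than \<open>c\<close> has this value, so one constant normalizes all Lagrange polynomials.
  By Wilson's theorem it is -1.\<close>

definition nonzero_prod :: "'a::{field, finite}" where
  "nonzero_prod = (\<Prod>e\<in>UNIV - {0}. e)"

definition lagrange :: "'a::{field, finite} \<Rightarrow> 'a poly" where
  "lagrange c = Polynomial.smult (inverse nonzero_prod) (\<Prod>d\<in>UNIV - {c}. [:- d, 1:])"

lemma nonzero_prod_neq_0 [simp]: "nonzero_prod \<noteq> 0"
  by (simp add: nonzero_prod_def)

lemma degree_lagrange: "Polynomial.degree (lagrange c :: 'a poly) = CARD('a::{field, finite}) - 1"
  by (simp add: lagrange_def degree_prod_eq_sum_degree)

lemma coeff_lagrange:
  "Polynomial.coeff (lagrange c) (CARD('a) - 1) = inverse (nonzero_prod :: 'a::{field, finite})"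
proof -
  have "lead_coeff (lagrange c) = inverse (nonzero_prod :: 'a)"
    by (simp add: lagrange_def lead_coeff_prod)
  then show ?thesis
    by (simp add: degree_lagrange)
qed

lemma poly_lagrange: "poly (lagrange c) x = (if x = c then 1 else 0)"
proof (cases "x = c")
  case True
  have "(\<Prod>d\<in>UNIV - {c}. c - d) = nonzero_prod"
    unfolding nonzero_prod_def
    by (rule prod.reindex_bij_witness[of _ "\<lambda>e. c - e" "\<lambda>d. c - d"]) auto
  then show ?thesis
    using True by (simp add: lagrange_def poly_prod)
next
  case False
  then show ?thesis
    by (auto simp: lagrange_def poly_prod)
qed

lemma poly_eqI_card:
  fixes f g :: "'a::{field, finite} poly"
  assumes "Polynomial.degree f < CARD('a)" "Polynomial.degree g < CARD('a)"
    and "\<And>x. poly f x = poly g x"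
  shows "f = g"
  using assms by (intro poly_eqI_degree[of UNIV]) auto

text \<open>Both sides have degree less than q and agree at all q elements of the field.\<close>

lemma sum_lagrange: "(\<Sum>c\<in>UNIV. Polynomial.smult (h c) (lagrange c)) = f"
  if "Polynomial.degree f < CARD('a)" "\<And>x. poly f x = h x" for f :: "'a::{field, finite} poly"
proof (rule poly_eqI_card)
  have "Polynomial.degree (\<Sum>c\<in>UNIV. Polynomial.smult (h c) (lagrange c)) \<le> CARD('a) - 1"
    by (intro degree_sum_le) (auto simp: degree_lagrange intro: order_trans[OF degree_smult_le])
  then show "Polynomial.degree (\<Sum>c\<in>UNIV. Polynomial.smult (h c) (lagrange c)) < CARD('a)"
    using zero_less_card_finite[where 'a = 'a] by linarith
qed (use that in \<open>simp_all add: poly_sum poly_lagrange if_distrib cong: if_cong\<close>)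

text \<open>Multiplication by \<open>x\<close> permutes the nonzero elements, so their product is
  unchanged by the factor \<open>x ^ (q - 1)\<close>.\<close>

lemma power_card_minus_1: "(x :: 'a::{field, finite}) ^ (CARD('a) - 1) = 1" if "x \<noteq> 0"
proof -
  have "nonzero_prod = (\<Prod>y\<in>UNIV - {0}. x * y)"
    unfolding nonzero_prod_def
    by (rule prod.reindex_bij_witness[of _ "\<lambda>y. x * y" "\<lambda>y. y / x"]) (use that in auto)
  also have "\<dots> = x ^ (CARD('a) - 1) * nonzero_prod"
    by (simp add: prod.distrib nonzero_prod_def)
  finally show ?thesis
    by simp
qed

lemma power_card: "(x :: 'a::{field, finite}) ^ CARD('a) = x"
proof (cases "x = 0")
  case False
  have "x ^ CARD('a) = x ^ (CARD('a) - 1) * x"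
    by (simp flip: power_Suc2)
  then show ?thesis
    using power_card_minus_1[OF False] by simp
qed simp

text \<open>Both sides are monic of degree q and vanish at all q field elements; their difference
  has degree less than q and q zeros.\<close>

lemma prod_linear_factors:
  "(\<Prod>c\<in>UNIV. [:- c, 1:]) = [:0, 1:] ^ CARD('a) - [:0, 1 :: 'a::{field, finite}:]"
proof (rule poly_eqI_degree_lead_coeff[where A = UNIV and n = "CARD('a)"])
  have gt: "CARD('a) > 1"
    using card_mono[of UNIV "{0, 1 :: 'a}"] by simp
  show "Polynomial.degree (\<Prod>c\<in>UNIV. [:- c, 1 :: 'a:]) \<le> CARD('a)"
    by (simp add: degree_prod_eq_sum_degree)
  show "Polynomial.degree ([:0, 1:] ^ CARD('a) - [:0, 1 :: 'a:]) \<le> CARD('a)"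
    using gt by (intro degree_diff_le) (auto simp: degree_power_eq)
  have "Polynomial.coeff (\<Prod>c\<in>UNIV. [:- c, 1 :: 'a:]) (CARD('a)) = 1"
    using lead_coeff_prod[of "\<lambda>c. [:- c, 1 :: 'a:]" UNIV] by (simp add: degree_prod_eq_sum_degree)
  moreover have "Polynomial.coeff ([:0, 1 :: 'a:] ^ CARD('a)) (CARD('a)) = 1"
    using lead_coeff_power[of "[:0, 1 :: 'a:]" "CARD('a)"] by (simp add: degree_power_eq)
  ultimately show "Polynomial.coeff (\<Prod>c\<in>UNIV. [:- c, 1 :: 'a:]) (CARD('a)) =
      Polynomial.coeff ([:0, 1:] ^ CARD('a) - [:0, 1 :: 'a:]) (CARD('a))"
    using gt by (simp add: coeff_eq_0)
qed (auto simp: poly_prod power_card)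

section \<open>Ideals containing the field equations\<close>

definition subst_poly :: "('v, 'a::comm_ring_1) mpoly \<Rightarrow> 'a poly \<Rightarrow> ('v, 'a) mpoly" where
  "subst_poly X f = poly (map_poly Const f) X"

lemma subst_poly_pCons [simp]: "subst_poly X (pCons a f) = Const a + X * subst_poly X f"
  by (simp add: subst_poly_def map_poly_pCons)

lemma subst_poly_0 [simp]: "subst_poly X 0 = 0"
  by (simp add: subst_poly_def)

lemma subst_poly_1 [simp]: "subst_poly X 1 = 1"
  by (simp add: subst_poly_def)

lemma subst_poly_add: "subst_poly X (f + g) = subst_poly X f + subst_poly X g"
  by (induction f g rule: poly_induct2) (simp_all add: Const_add algebra_simps)

lemma subst_poly_diff: "subst_poly X (f - g) = subst_poly X f - subst_poly X g"
  using subst_poly_add[of X "f - g" g] by simp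

lemma subst_poly_smult: "subst_poly X (Polynomial.smult c f) = Const c * subst_poly X f"
  by (induction f) (simp_all add: Const_mult algebra_simps)

lemma subst_poly_mult: "subst_poly X (f * g) = subst_poly X f * subst_poly X g"
  by (induction f) (simp_all add: subst_poly_add subst_poly_smult algebra_simps)

lemma subst_poly_sum: "subst_poly X (\<Sum>i\<in>A. f i) = (\<Sum>i\<in>A. subst_poly X (f i))"
  by (induction A rule: infinite_finite_induct) (simp_all add: subst_poly_add)

lemma subst_poly_power: "subst_poly X (f ^ n) = subst_poly X f ^ n"
  by (induction n) (simp_all add: subst_poly_mult)

lemma subst_poly_carrier [simp]:
  "X \<in> carrier (mpoly_ring V) \<Longrightarrow> subst_poly X f \<in> carrier (mpoly_ring V)"
  by (induction f) simp_all

lemma eval_subst_poly [simp]: "eval_mpoly s (subst_poly X f) = poly f (eval_mpoly s X)"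
  by (induction f) simp_all

lemma Const_eq_0_iff [simp]: "Const c = 0 \<longleftrightarrow> c = 0"
  by (metis Const_0 eval_mpoly_Const)

lemma mpoly_ring_ring: "ring (mpoly_ring V)"
  using cring_mpoly_ring by (rule cring.axioms(1))

lemma mpoly_a_inv [simp]:
  "p \<in> carrier (mpoly_ring V) \<Longrightarrow> \<ominus>\<^bsub>mpoly_ring V\<^esub> p = - p"
  by (rule abelian_group.minus_equality[OF ring.is_abelian_group[OF mpoly_ring_ring]]) simp_all

lemma mpoly_a_minus [simp]:
  "p \<in> carrier (mpoly_ring V) \<Longrightarrow> q \<in> carrier (mpoly_ring V) \<Longrightarrow> p \<ominus>\<^bsub>mpoly_ring V\<^esub> q = p - q"
  by (simp add: a_minus_def)

text \<open>The image of this field in a proper quotient is the scalar field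
  \<open>quot_scalars\<close>; the uniqueness of dimension used in \<open>quot_dim_eq\<close> is
  stated for subfields.\<close>

lemma subfield_Const: "subfield (range (Const :: 'a::field \<Rightarrow> _)) (mpoly_ring V)"
proof -
  interpret R: cring "mpoly_ring V :: ('b, 'a) mpoly ring"
    by (rule cring_mpoly_ring)
  let ?K = "range (Const :: 'a \<Rightarrow> ('b, 'a) mpoly)"
  have Units: "Units (mpoly_ring V\<lparr>carrier := ?K\<rparr>) = ?K - {0}"
  proof
    have "Const (c :: 'a) \<noteq> (0 :: ('b, 'a) mpoly)" if "Const d * Const c = (1 :: ('b, 'a) mpoly)" for c d
      using that by auto
    then show "Units (mpoly_ring V\<lparr>carrier := ?K\<rparr>) \<subseteq> ?K - {0}"
      by (auto simp: Units_def)
    show "?K - {0} \<subseteq> Units (mpoly_ring V\<lparr>carrier := ?K\<rparr>)"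
    proof
      fix x assume "x \<in> ?K - {0}"
      then obtain c where c: "x = Const c" "c \<noteq> 0"
        by auto
      then have "Const (inverse c) * x = 1" "x * Const (inverse c) = 1"
        by (simp_all flip: Const_mult)
      then show "x \<in> Units (mpoly_ring V\<lparr>carrier := ?K\<rparr>)"
        using c by (auto simp: Units_def)
    qed
  qed
  show ?thesis
  proof (rule R.subfieldI)
    show "subcring ?K (mpoly_ring V)"
    proof (rule R.subcringI', rule R.subringI)
      show "\<one>\<^bsub>mpoly_ring V\<^esub> \<in> ?K"
        using Const_1 by (metis mpoly_ring_sel(2) rangeI)
    qed (auto simp flip: Const_mult Const_add Const_uminus)
  qed (simp add: Units)
qed

text \<open>Collects what the two ideals share, so that radicality, zero-dimensionality and the
  dimension count are proved once for both.\<close>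

locale finite_field_ideal =
  fixes V :: "'v set" and I :: "('v, 'a::{field, finite}) mpoly set"
  assumes finite_V: "finite V"
    and ideal_I: "ideal I (mpoly_ring V)"
    and field_eq: "v \<in> V \<Longrightarrow> Var v ^ CARD('a) - Var v \<in> I"
begin

abbreviation R :: "('v, 'a) mpoly ring" where "R \<equiv> mpoly_ring V"

abbreviation Z :: "('v \<Rightarrow> 'a) set" where "Z \<equiv> zero_set V I"

sublocale ideal I R
  by (rule ideal_I)

lemma I_carrier: "p \<in> I \<Longrightarrow> p \<in> carrier R"
  by (rule a_Hcarr)

lemma I_zero: "0 \<in> I"
  using additive_subgroup.zero_closed[OF additive_subgroup_axioms] by simp

lemma I_add: "p \<in> I \<Longrightarrow> q \<in> I \<Longrightarrow> p + q \<in> I"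
  using additive_subgroup.a_closed[OF additive_subgroup_axioms, of p q] by simp

lemma I_mult: "p \<in> I \<Longrightarrow> q \<in> carrier R \<Longrightarrow> q * p \<in> I"
  using I_l_closed[of p q] by simp

lemma I_diff: "p \<in> I \<Longrightarrow> q \<in> I \<Longrightarrow> p - q \<in> I"
  using I_add[of p "- q"] I_mult[of q "- 1"] by simp

lemma I_sum: "(\<And>i. i \<in> A \<Longrightarrow> f i \<in> I) \<Longrightarrow> (\<Sum>i\<in>A. f i) \<in> I"
  by (induction A rule: infinite_finite_induct) (auto simp: I_zero I_add)

definition delta :: "('v \<Rightarrow> 'a) \<Rightarrow> ('v, 'a) mpoly" where
  "delta s = (\<Prod>v\<in>V. subst_poly (Var v) (lagrange (s v)))"

lemma delta_carrier [simp]: "delta s \<in> carrier R"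
  by (simp add: delta_def)

lemma eval_delta:
  assumes "s \<in> V \<rightarrow>\<^sub>E UNIV" "t \<in> V \<rightarrow>\<^sub>E UNIV"
  shows "eval_mpoly t (delta s) = (if t = s then 1 else 0)"
proof (cases "t = s")
  case False
  then obtain v where "v \<in> V" "t v \<noteq> s v"
    using PiE_ext[OF assms(2,1)] by blast
  then show ?thesis
    using False finite_V by (auto simp: delta_def poly_lagrange)
qed (simp add: delta_def poly_lagrange)

text \<open>In each variable the Lagrange polynomials sum to 1. Expanding the product of these sums
  over the variables gives one summand \<open>delta s\<close> per point.\<close>

lemma sum_delta: "(\<Sum>s\<in>V \<rightarrow>\<^sub>E UNIV. delta s) = 1"
proof -
  have "(\<Sum>c\<in>UNIV. lagrange (c :: 'a)) = 1"
    using sum_lagrange[of "1 :: 'a poly" "\<lambda>_. 1"] by simp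
  then have "(\<Prod>v\<in>V. \<Sum>c\<in>UNIV. subst_poly (Var v) (lagrange (c :: 'a))) = 1"
    by (simp flip: subst_poly_sum)
  then show ?thesis
    using prod_sum_PiE[OF finite_V, of "\<lambda>_. UNIV" "\<lambda>v c. subst_poly (Var v) (lagrange (c :: 'a))"]
    by (simp add: delta_def)
qed

text \<open>The factor \<open>Var v - Const (s v)\<close> is the one missing from the Lagrange
  polynomial at \<open>s v\<close>. It completes the product of all linear factors to a multiple of
  \<open>x ^ q - x\<close>, the field equation of \<open>v\<close>.\<close>

lemma Var_mult_delta:
  assumes "v \<in> V"
  shows "Var v * delta s - Const (s v) * delta s \<in> I"
proof -
  let ?rest = "\<Prod>u\<in>V - {v}. subst_poly (Var u) (lagrange (s u))"
  have delta: "delta s = subst_poly (Var v) (lagrange (s v)) * ?rest"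
    unfolding delta_def using finite_V assms by (rule prod.remove)
  have factors: "[:- s v, 1:] * lagrange (s v) =
      Polynomial.smult (inverse nonzero_prod) (\<Prod>d\<in>UNIV. [:- d, 1:])"
    unfolding lagrange_def by (subst prod.remove[of UNIV "s v"]) simp_all
  have "subst_poly (Var v :: ('v, 'a) mpoly) ([:- s v, 1:] * lagrange (s v)) =
      Const (inverse nonzero_prod) * (Var v ^ CARD('a) - Var v)"
    unfolding factors prod_linear_factors subst_poly_smult subst_poly_diff subst_poly_power by simp
  moreover have "subst_poly (Var v :: ('v, 'a) mpoly) [:- s v, 1:] = Var v - Const (s v)"
    by (simp add: Const_uminus)
  ultimately have "(Var v - Const (s v)) * subst_poly (Var v) (lagrange (s v)) =
      Const (inverse nonzero_prod) * (Var v ^ CARD('a) - Var v)"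
    by (simp only: subst_poly_mult)
  then have "(Var v - Const (s v)) * delta s =
      Const (inverse nonzero_prod) * (Var v ^ CARD('a) - Var v) * ?rest"
    unfolding delta by (simp only: mult.assoc[symmetric])
  then have "Var v * delta s - Const (s v) * delta s =
      (Const (inverse nonzero_prod) * ?rest) * (Var v ^ CARD('a) - Var v)"
    by (simp only: left_diff_distrib[symmetric] mult.assoc mult.commute[of _ ?rest])
  moreover have "\<dots> \<in> I"
    by (intro I_mult field_eq) (use assms in \<open>auto intro!: mpoly_carrier_mult mpoly_carrier_prod\<close>)
  ultimately show ?thesis by simp
qed

lemma mult_delta:
  assumes "p \<in> carrier R"
  shows "p * delta s - Const (eval_mpoly s p) * delta s \<in> I"
  using assms
proof (induction rule: mpoly_induct)
  case (Const c)
  then show ?case by (simp add: I_zero)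
next
  case (Var v)
  then show ?case using Var_mult_delta by simp
next
  case (add p q)
  then show ?case
    using I_add[OF add.IH] by (simp add: Const_add algebra_simps)
next
  case (mult p q)
  \<comment> \<open>First \<open>q\<close>, then \<open>p\<close>, is replaced by its value at
    \<open>s\<close>; the intermediate term \<open>p * Const (q(s)) * delta s\<close>
    cancels.\<close>
  have eq: "p * q * delta s - Const (eval_mpoly s (p * q)) * delta s =
      p * (q * delta s - Const (eval_mpoly s q) * delta s) +
      Const (eval_mpoly s q) * (p * delta s - Const (eval_mpoly s p) * delta s)"
    by (simp add: Const_mult algebra_simps)
  show ?case
    unfolding eq using mult by (intro I_add I_mult) auto
qed

text \<open>Some \<open>g\<close> in \<open>I\<close> has a nonzero value at \<open>s\<close>.
  Modulo \<open>I\<close>, \<open>delta s\<close> times this value equals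
  \<open>g * delta s\<close>, hence 0, and the value is invertible.\<close>

lemma delta_mem:
  assumes "s \<in> V \<rightarrow>\<^sub>E UNIV" "s \<notin> Z"
  shows "delta s \<in> I"
proof -
  obtain g where g: "g \<in> I" "eval_mpoly s g \<noteq> 0"
    using assms by (auto simp: zero_set_def)
  let ?c = "eval_mpoly s g"
  have "g * delta s \<in> I"
    using I_mult[OF g(1) delta_carrier] by (simp add: mult.commute)
  from I_diff[OF this mult_delta[OF I_carrier[OF g(1)], of s]] have "Const ?c * delta s \<in> I"
    by simp
  then have "Const (inverse ?c) * (Const ?c * delta s) \<in> I"
    by (rule I_mult) simp
  then show ?thesis
    using g(2) by (simp add: mult.assoc[symmetric] flip: Const_mult)
qed

text \<open>A Nullstellensatz over the finite field itself: write \<open>p\<close> as the sum of all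
  \<open>p * delta s\<close>. At a zero of \<open>I\<close> the summand is in \<open>I\<close>
  because \<open>p\<close> vanishes there, at any other point because \<open>delta s\<close> is in
  \<open>I\<close>.\<close>

lemma mem_I_iff: "p \<in> I \<longleftrightarrow> p \<in> carrier R \<and> (\<forall>s\<in>Z. eval_mpoly s p = 0)"
proof (intro iffI conjI ballI)
  assume *: "p \<in> carrier R \<and> (\<forall>s\<in>Z. eval_mpoly s p = 0)"
  have "p * delta s \<in> I" if s: "s \<in> V \<rightarrow>\<^sub>E UNIV" for s
  proof (cases "s \<in> Z")
    case True
    then show ?thesis using mult_delta[of p s] * by simp
  next
    case False
    then show ?thesis using delta_mem[OF s] * I_mult by blast
  qed
  then have "(\<Sum>s\<in>V \<rightarrow>\<^sub>E UNIV. p * delta s) \<in> I"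
    by (rule I_sum)
  then show "p \<in> I"
    by (simp add: sum_delta flip: sum_distrib_left)
qed (auto simp: zero_set_def I_carrier)

text \<open>A field has no nonzero nilpotents, so \<open>p\<close> vanishes on \<open>Z\<close> as
  soon as some positive power of it does.\<close>

lemma radical: "radical_ideal I R"
proof -
  have "ideal_radical R I = I"
  proof (intro equalityI subsetI)
    fix p assume "p \<in> ideal_radical R I"
    then obtain n :: nat where "p \<in> carrier R" "n > 0" "p ^ n \<in> I"
      unfolding ideal_radical_def mpoly_pow by blast
    then show "p \<in> I"
      unfolding mem_I_iff by simp
  next
    fix p assume p: "p \<in> I"
    then have "p ^ 1 \<in> I"
      by simp
    then show "p \<in> ideal_radical R I"
      unfolding ideal_radical_def mpoly_pow using I_carrier[OF p] zero_less_one by blast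
  qed
  then show ?thesis
    unfolding radical_ideal_def using ideal_I by blast
qed

section \<open>Dimension of the quotient\<close>

lemma finite_Z: "finite Z"
  by (rule finite_subset[of _ "V \<rightarrow>\<^sub>E UNIV"]) (auto simp: zero_set_def intro: finite_PiE finite_V)

lemma coset_eq_iff:
  assumes "p \<in> carrier R" "q \<in> carrier R"
  shows "I +>\<^bsub>R\<^esub> p = I +>\<^bsub>R\<^esub> q \<longleftrightarrow> p - q \<in> I"
  using quotient_eq_iff_same_a_r_cos[OF ideal_I assms] assms by simp

sublocale Q: ring "R Quot I"
  by (rule quotient_is_ring)

sublocale coset: ring_hom_ring R "R Quot I" "(+>\<^bsub>R\<^esub>) I"
  by (rule rcos_ring_hom_ring)

text \<open>Adding a point \<open>s\<close> to \<open>T\<close> adjoins the class of \<open>delta s\<close> to the space of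
  classes vanishing on \<open>Z - T\<close>.\<close>

lemma dimension_vanishing:
  assumes "T \<subseteq> Z"
  shows "Q.dimension (card T) (quot_scalars V I)
    ((+>\<^bsub>R\<^esub>) I ` {p \<in> carrier R. \<forall>s\<in>Z - T. eval_mpoly s p = 0})"
proof -
  let ?E = "\<lambda>T. (+>\<^bsub>R\<^esub>) I ` {p \<in> carrier R. \<forall>s\<in>Z - T. eval_mpoly s p = 0}"
  have "finite T"
    using finite_subset[OF assms finite_Z] .
  then show ?thesis
    using assms
  proof (induction T rule: finite_induct)
    case empty
    have "{p \<in> carrier R. \<forall>s\<in>Z - {}. eval_mpoly s p = 0} = I"
      using mem_I_iff by auto
    moreover have "(+>\<^bsub>R\<^esub>) I ` I = {\<zero>\<^bsub>R Quot I\<^esub>}"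
    proof -
      have "I +>\<^bsub>R\<^esub> p = \<zero>\<^bsub>R Quot I\<^esub>" if "p \<in> I" for p
        using coset_eq_iff[of p 0] that I_carrier coset.hom_zero by simp
      then show ?thesis
        using I_zero by auto
    qed
    ultimately show ?case
      by simp
  next
    case (insert s T)
    have s: "s \<in> Z" "s \<in> V \<rightarrow>\<^sub>E UNIV" and Z: "\<And>t. t \<in> Z \<Longrightarrow> t \<in> V \<rightarrow>\<^sub>E UNIV"
      using insert.prems by (auto simp: zero_set_def)
    \<comment> \<open>Every element of \<open>I\<close> vanishes at \<open>s\<close>, and so does
      every representative allowed for \<open>?E T\<close>, since \<open>s\<close> is not in
      \<open>T\<close>; but \<open>delta s\<close> takes the value 1 there.\<close>
    have not_mem: "I +>\<^bsub>R\<^esub> delta s \<notin> ?E T"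
    proof
      assume "I +>\<^bsub>R\<^esub> delta s \<in> ?E T"
      then obtain p where p: "p \<in> carrier R" "eval_mpoly s p = 0" "delta s - p \<in> I"
        using s insert.hyps coset_eq_iff by auto
      then have "eval_mpoly s (delta s - p) = 0"
        using s mem_I_iff by blast
      then show False
        using p s by (simp add: eval_delta)
    qed
    have "Q.line_extension (quot_scalars V I) (I +>\<^bsub>R\<^esub> delta s) (?E T) = ?E (insert s T)"
    proof (intro equalityI subsetI)
      fix u assume "u \<in> Q.line_extension (quot_scalars V I) (I +>\<^bsub>R\<^esub> delta s) (?E T)"
      then obtain c p where p: "p \<in> carrier R" "\<forall>t\<in>Z - T. eval_mpoly t p = 0"
        and u: "u = (I +>\<^bsub>R\<^esub> Const c) \<otimes>\<^bsub>R Quot I\<^esub> (I +>\<^bsub>R\<^esub> delta s) \<oplus>\<^bsub>R Quot I\<^esub> (I +>\<^bsub>R\<^esub> p)"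
        unfolding Q.line_extension_mem_iff quot_scalars_def by blast
      have "u = I +>\<^bsub>R\<^esub> (Const c * delta s + p)"
        using u p(1) coset.hom_add[of "Const c * delta s" p] coset.hom_mult[of "Const c" "delta s"]
        by simp
      then show "u \<in> ?E (insert s T)"
        using p s Z by (intro image_eqI) (auto simp: eval_delta split: if_splits)
    next
      fix u assume "u \<in> ?E (insert s T)"
      then obtain p where p: "p \<in> carrier R" "\<forall>t\<in>Z - insert s T. eval_mpoly t p = 0"
        "u = I +>\<^bsub>R\<^esub> p"
        by auto
      let ?c = "eval_mpoly s p"
      \<comment> \<open>Subtracting the value at \<open>s\<close> times \<open>delta s\<close> makes
        the remainder vanish at \<open>s\<close> and changes nothing at the other zeros.\<close>
      let ?r = "p - Const ?c * delta s"
      have "u = (I +>\<^bsub>R\<^esub> Const ?c) \<otimes>\<^bsub>R Quot I\<^esub> (I +>\<^bsub>R\<^esub> delta s) \<oplus>\<^bsub>R Quot I\<^esub> (I +>\<^bsub>R\<^esub> ?r)"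
        using p coset.hom_add[of "Const ?c * delta s" ?r] coset.hom_mult[of "Const ?c" "delta s"]
        by simp
      moreover have "I +>\<^bsub>R\<^esub> ?r \<in> ?E T"
        using p s Z by (intro imageI) (auto simp: eval_delta)
      ultimately show "u \<in> Q.line_extension (quot_scalars V I) (I +>\<^bsub>R\<^esub> delta s) (?E T)"
        unfolding Q.line_extension_mem_iff quot_scalars_def by blast
    qed
    moreover have "Q.dimension (Suc (card T)) (quot_scalars V I)
        (Q.line_extension (quot_scalars V I) (I +>\<^bsub>R\<^esub> delta s) (?E T))"
      using insert not_mem by (intro Q.Suc_dim) (auto intro: coset.hom_closed)
    ultimately show ?case
      using insert.hyps by simp
  qed
qed

lemma dimension_carrier: "Q.dimension (card Z) (quot_scalars V I) (carrier (R Quot I))"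
proof -
  have "carrier (R Quot I) = (+>\<^bsub>R\<^esub>) I ` carrier R"
    by (auto simp: FactRing_def A_RCOSETS_def')
  \<comment> \<open>For \<open>T = Z\<close> the vanishing condition is empty.\<close>
  then show ?thesis
    using dimension_vanishing[of Z] by simp
qed

lemma zero_dim: "zero_dimensional V I"
  unfolding zero_dimensional_def
  using ideal_I Q.finite_dimensionI[OF dimension_carrier] by blast

lemma quot_dim_eq:
  assumes "Z \<noteq> {}"
  shows "quot_dim V I = card Z"
proof -
  \<comment> \<open>A zero of \<open>I\<close> keeps 1 out of \<open>I\<close>. In the zero ring the
    classes of the constants would not form a field, and \<open>Q.dimI\<close> could not be
    applied.\<close>
  have "1 \<notin> I"
    using assms mem_I_iff by auto
  then have "\<one>\<^bsub>R Quot I\<^esub> \<noteq> \<zero>\<^bsub>R Quot I\<^esub>"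
    using coset_eq_iff[of 1 0] coset.hom_one coset.hom_zero by simp
  then have "subfield (quot_scalars V I) (R Quot I)"
    using coset.img_is_subfield(2)[OF subfield_Const]
    by (simp add: quot_scalars_def image_image)
  from Q.dimI[OF this dimension_carrier] show ?thesis
    by (simp add: quot_dim_def over_def)
qed

end

section \<open>Zero sets of ideals given by generators\<close>

lemma ideal_vanishing: "ideal {p \<in> carrier (mpoly_ring V). eval_mpoly s p = 0} (mpoly_ring V)"
proof -
  interpret R: cring "mpoly_ring V :: ('a, 'b) mpoly ring"
    by (rule cring_mpoly_ring)
  show ?thesis
  proof (rule idealI[OF R.ring_axioms])
    show "subgroup {p \<in> carrier (mpoly_ring V). eval_mpoly s p = (0 :: 'b)} (add_monoid (mpoly_ring V))"
    proof (rule R.add.subgroupI)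
      fix p :: "('a, 'b) mpoly"
      assume p: "p \<in> {p \<in> carrier (mpoly_ring V). eval_mpoly s p = 0}"
      then show "\<ominus>\<^bsub>mpoly_ring V\<^esub> p \<in> {p \<in> carrier (mpoly_ring V). eval_mpoly s p = 0}"
        using eval_mpoly_diff[of s 0 p] by simp
    qed (use eval_mpoly_zero in \<open>auto intro: mpoly_carrier_zero_one\<close>)
  qed auto
qed

text \<open>The polynomials vanishing at a common zero of the generators form an ideal containing
  \<open>A\<close> and \<open>B\<close>, hence containing both generated ideals and their
  sum.\<close>

lemma zero_set_Idl_add:
  assumes "A \<subseteq> carrier (mpoly_ring V)" "B \<subseteq> carrier (mpoly_ring V)"
  shows "zero_set V (Idl\<^bsub>mpoly_ring V\<^esub> A <+>\<^bsub>mpoly_ring V\<^esub> Idl\<^bsub>mpoly_ring V\<^esub> B) =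
    {s \<in> V \<rightarrow>\<^sub>E UNIV. \<forall>p \<in> A \<union> B. eval_mpoly s p = 0}"
proof -
  interpret R: cring "mpoly_ring V :: ('a, 'b) mpoly ring"
    by (rule cring_mpoly_ring)
  let ?IA = "Idl\<^bsub>mpoly_ring V\<^esub> A" and ?IB = "Idl\<^bsub>mpoly_ring V\<^esub> B"
  have zero: "0 \<in> ?IA" "0 \<in> ?IB"
    using additive_subgroup.zero_closed[OF ideal.axioms(1)[OF R.genideal_ideal[OF assms(1)]]]
      additive_subgroup.zero_closed[OF ideal.axioms(1)[OF R.genideal_ideal[OF assms(2)]]]
    by simp_all
  have sum: "?IA <+>\<^bsub>mpoly_ring V\<^esub> ?IB = {a + b | a b. a \<in> ?IA \<and> b \<in> ?IB}"
    by (auto simp: set_add_def')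
  have add_mem: "a + b \<in> ?IA <+>\<^bsub>mpoly_ring V\<^esub> ?IB" if "a \<in> ?IA" "b \<in> ?IB" for a b
    using that unfolding sum by blast
  have "A \<union> B \<subseteq> ?IA <+>\<^bsub>mpoly_ring V\<^esub> ?IB"
  proof
    fix p assume "p \<in> A \<union> B"
    then have "p \<in> ?IA \<or> p \<in> ?IB"
      using R.genideal_self[OF assms(1)] R.genideal_self[OF assms(2)] by blast
    then show "p \<in> ?IA <+>\<^bsub>mpoly_ring V\<^esub> ?IB"
      using add_mem[of p 0] add_mem[of 0 p] zero by auto
  qed
  moreover have "eval_mpoly s p = 0"
    if "\<forall>p \<in> A \<union> B. eval_mpoly s p = 0" "p \<in> ?IA <+>\<^bsub>mpoly_ring V\<^esub> ?IB" for s p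
  proof -
    have "A \<subseteq> {p \<in> carrier (mpoly_ring V). eval_mpoly s p = 0}"
      "B \<subseteq> {p \<in> carrier (mpoly_ring V). eval_mpoly s p = 0}"
      using assms that(1) by auto
    then have "?IA \<subseteq> {p \<in> carrier (mpoly_ring V). eval_mpoly s p = 0}"
      "?IB \<subseteq> {p \<in> carrier (mpoly_ring V). eval_mpoly s p = 0}"
      using R.genideal_minimal[OF ideal_vanishing] by blast+
    moreover from that(2) obtain a b where p: "p = a + b" "a \<in> ?IA" "b \<in> ?IB"
      unfolding sum by blast
    ultimately have "eval_mpoly s a = 0" "eval_mpoly s b = 0"
      by blast+
    then show ?thesis
      by (simp add: p)
  qed
  ultimately show ?thesis
    unfolding zero_set_def by blast
qed

text \<open>The field equations hold at every point because \<open>a ^ q = a\<close>, so only the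
  generators in \<open>A\<close> restrict the zero set.\<close>

lemma
  fixes V :: "'v set" and A :: "('v, 'a::{field, finite}) mpoly set"
  defines "J \<equiv> Idl\<^bsub>mpoly_ring V\<^esub> A <+>\<^bsub>mpoly_ring V\<^esub>
    Idl\<^bsub>mpoly_ring V\<^esub> {Var v ^ CARD('a) - Var v | v. v \<in> V}"
  assumes V: "finite V" and A: "A \<subseteq> carrier (mpoly_ring V)"
  shows finite_field_ideal_Idl: "finite_field_ideal V J"
    and zero_set_Idl: "zero_set V J = {s \<in> V \<rightarrow>\<^sub>E UNIV. \<forall>p \<in> A. eval_mpoly s p = 0}"
proof -
  interpret R: cring "mpoly_ring V :: ('v, 'a) mpoly ring"
    by (rule cring_mpoly_ring)
  let ?B = "{Var v ^ CARD('a) - Var v | v. v \<in> V} :: ('v, 'a) mpoly set"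
  have B: "?B \<subseteq> carrier (mpoly_ring V)"
    by auto
  have "0 \<in> Idl\<^bsub>mpoly_ring V\<^esub> A"
    using additive_subgroup.zero_closed[OF ideal.axioms(1)[OF R.genideal_ideal[OF A]]] by simp
  then have "0 + p \<in> J" if "p \<in> ?B" for p
    unfolding J_def set_add_def' mpoly_ring_sel using R.genideal_self[OF B] that by blast
  then show "finite_field_ideal V J"
    unfolding finite_field_ideal_def
    using V R.add_ideals[OF R.genideal_ideal[OF A] R.genideal_ideal[OF B]]
    by (auto simp: J_def)
  show "zero_set V J = {s \<in> V \<rightarrow>\<^sub>E UNIV. \<forall>p \<in> A. eval_mpoly s p = 0}"
    unfolding J_def zero_set_Idl_add[OF A B] by (auto simp: power_card)
qed

section \<open>Permutation polynomials\<close>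

lemma F_carrier [simp]: "p \<in> carrier (mpoly_ring V) \<Longrightarrow> F p \<in> carrier (mpoly_ring V)"
  by (simp add: F_def)

text \<open>\<open>t ^ (q - 1)\<close> is 1 for nonzero \<open>t\<close> and 0 for
  \<open>t = 0\<close>. Thus \<open>F\<close> turns an inequation into an equation.\<close>

lemma eval_F_eq_0_iff:
  "eval_mpoly s (F p :: ('v, 'a::{field, finite}) mpoly) = 0 \<longleftrightarrow> eval_mpoly s p \<noteq> 0"
proof -
  have "CARD('a) - 1 > 0"
    using card_mono[of UNIV "{0, 1 :: 'a}"] by simp
  then show ?thesis
    using power_card_minus_1[of "eval_mpoly s p"] by (auto simp: F_def power_0_left)
qed

lemma bij_iff_distinct: "bij f \<longleftrightarrow> (\<forall>a b. a \<noteq> b \<longrightarrow> f a \<noteq> f b)" for f :: "'a::finite \<Rightarrow> 'a"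
  by (metis bij_def finite_UNIV_inj_surj finite injD injI)

text \<open>Scaling by some \<open>g\<close> other than 0 and 1 permutes the field, so the sum is
  fixed by multiplication with \<open>g\<close>.\<close>

lemma sum_UNIV_field:
  assumes "CARD('a::{field, finite}) > 2"
  shows "(\<Sum>a\<in>UNIV. a :: 'a) = 0"
proof -
  have "UNIV \<noteq> {0, 1 :: 'a}"
    using assms by (metis card_2_iff less_irrefl zero_neq_one)
  then obtain g :: 'a where g: "g \<noteq> 0" "g \<noteq> 1"
    by auto
  have "(\<Sum>a\<in>UNIV. a) = (\<Sum>a\<in>UNIV. g * a)"
    by (rule sum.reindex_bij_witness[of _ "\<lambda>a. g * a" "\<lambda>a. a / g"]) (use g in auto)
  also have "\<dots> = g * (\<Sum>a\<in>UNIV. a)"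
    by (simp only: sum_distrib_left)
  finally have "(g - 1) * (\<Sum>a\<in>UNIV. a) = 0"
    by (metis diff_self left_diff_distrib mult_1)
  then show ?thesis
    using g by simp
qed

text \<open>By Lagrange interpolation the coefficient of \<open>x ^ (q - 1)\<close> is a multiple of the sum of all
  values, and the elements of the field sum up to 0.\<close>

lemma coeff_perm_poly:
  fixes f :: "'a::{field, finite} poly"
  assumes "CARD('a) > 2" "Polynomial.degree f < CARD('a)" "bij (poly f)"
  shows "Polynomial.coeff f (CARD('a) - 1) = 0"
proof -
  have "Polynomial.coeff f (CARD('a) - 1) =
      Polynomial.coeff (\<Sum>c\<in>UNIV. Polynomial.smult (poly f c) (lagrange c)) (CARD('a) - 1)"
    using sum_lagrange[OF assms(2), of "poly f"] by simp
  also have "\<dots> = (\<Sum>c\<in>UNIV. poly f c) * inverse nonzero_prod"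
    by (simp add: coeff_sum coeff_lagrange sum_distrib_right del: One_nat_def)
  also have "(\<Sum>c\<in>UNIV. poly f c) = (\<Sum>c\<in>UNIV. c)"
    using sum.reindex_bij_betw[OF assms(3), of "\<lambda>c. c"] by simp
  finally show ?thesis
    using sum_UNIV_field[OF assms(1)] by simp
qed

lemma coeff_top_eq_0:
  assumes "Polynomial.degree f < q" "Polynomial.coeff f (q - 1) = 0" "i > q - (2::nat)"
  shows "Polynomial.coeff f i = 0"
proof (cases "i = q - 1")
  case False
  then show ?thesis
    using assms by (intro coeff_eq_0) linarith
qed (use assms in simp)

lemma coeff_poly_of_point:
  fixes s :: "nat \<Rightarrow> 'a::{field, finite}"
  shows "Polynomial.coeff (poly_of_point s) i = (if i \<le> CARD('a) - 2 then s i else 0)"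
  by (auto simp: poly_of_point_def coeff_sum)

lemma poly_poly_of_point:
  fixes s :: "nat \<Rightarrow> 'a::{field, finite}"
  shows "poly (poly_of_point s) x = (\<Sum>i = 0..CARD('a) - 2. s i * x ^ i)"
  by (simp add: poly_of_point_def poly_sum poly_monom)

text \<open>At \<open>s\<close> the argument of \<open>F\<close> is f(a) - f(b), where f is the
  polynomial with coefficients \<open>s\<close>. All generators together express injectivity of f,
  which on a finite field is bijectivity.\<close>

lemma eval_F_gen:
  "eval_mpoly s (F_gen a b) = 0 \<longleftrightarrow> poly (poly_of_point s) a \<noteq> poly (poly_of_point s) b"
  unfolding F_gen_def eval_F_eq_0_iff poly_poly_of_point
  by (simp add: left_diff_distrib right_diff_distrib sum_subtractf mult_ac)

lemma
  shows finite_field_ideal_I: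
      "finite_field_ideal (X_vars TYPE('a)) (I_ideal :: (nat, 'a::{field, finite}) mpoly set)"
    and zero_set_I: "zero_set (X_vars TYPE('a)) (I_ideal :: (nat, 'a) mpoly set) =
      {s \<in> X_vars TYPE('a) \<rightarrow>\<^sub>E UNIV. bij (poly (poly_of_point s))}"
proof -
  have fin: "finite (X_vars TYPE('a))"
    by (simp add: X_vars_def)
  have gens: "{F_gen a b | a b :: 'a. a \<noteq> b} \<subseteq> carrier (mpoly_ring (X_vars TYPE('a)))"
    by (auto simp: F_gen_def X_vars_def intro!: F_carrier mpoly_carrier_sum mpoly_carrier_mult)
  show "finite_field_ideal (X_vars TYPE('a)) (I_ideal :: (nat, 'a) mpoly set)"
    unfolding I_ideal_def Let_def by (rule finite_field_ideal_Idl[OF fin gens])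
  show "zero_set (X_vars TYPE('a)) (I_ideal :: (nat, 'a) mpoly set) =
      {s \<in> X_vars TYPE('a) \<rightarrow>\<^sub>E UNIV. bij (poly (poly_of_point s))}"
    unfolding I_ideal_def Let_def zero_set_Idl[OF fin gens] bij_iff_distinct
    using eval_F_gen by blast
qed

lemma bij_betw_poly_of_point:
  assumes "CARD('a::{field, finite}) > 2"
  shows "bij_betw poly_of_point
    (zero_set (X_vars TYPE('a)) (I_ideal :: (nat, 'a) mpoly set)) perm_polys"
proof (rule bij_betwI[where g = "\<lambda>f. restrict (Polynomial.coeff f) (X_vars TYPE('a))"])
  have deg: "Polynomial.degree (poly_of_point s) < CARD('a)" for s :: "nat \<Rightarrow> 'a"
    using assms by (intro degree_lessI) (auto simp: coeff_poly_of_point)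
  show "poly_of_point \<in> zero_set (X_vars TYPE('a)) (I_ideal :: (nat, 'a) mpoly set) \<rightarrow> perm_polys"
    by (auto simp: zero_set_I perm_polys_def deg)
  \<comment> \<open>The restriction to indices up to q - 2 loses nothing, since the coefficient at q
    - 1 of a permutation polynomial is 0.\<close>
  have inverse: "poly_of_point (restrict (Polynomial.coeff f) (X_vars TYPE('a))) = f"
    if f: "f \<in> perm_polys" for f :: "'a poly"
  proof (rule poly_eqI)
    fix i
    have "Polynomial.degree f < CARD('a)" "bij (poly f)"
      using f by (simp_all add: perm_polys_def)
    then have "Polynomial.coeff f i = 0" if "i > CARD('a) - 2"
      using coeff_top_eq_0 coeff_perm_poly[OF assms] that by blast
    then show "Polynomial.coeff (poly_of_point (restrict (Polynomial.coeff f) (X_vars TYPE('a)))) i =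
        Polynomial.coeff f i"
      by (auto simp: coeff_poly_of_point X_vars_def)
  qed
  then show "poly_of_point (restrict (Polynomial.coeff f) (X_vars TYPE('a))) = f"
    if "f \<in> perm_polys" for f :: "'a poly"
    using that .
  \<comment> \<open>By \<open>inverse\<close>, the polynomial of the restricted coefficient vector
    is \<open>f\<close> itself, hence a permutation.\<close>
  show "(\<lambda>f. restrict (Polynomial.coeff f) (X_vars TYPE('a))) \<in>
      perm_polys \<rightarrow> zero_set (X_vars TYPE('a)) (I_ideal :: (nat, 'a) mpoly set)"
    using inverse by (auto simp: zero_set_I perm_polys_def)
  show "restrict (Polynomial.coeff (poly_of_point s)) (X_vars TYPE('a)) = s"
    if "s \<in> zero_set (X_vars TYPE('a)) (I_ideal :: (nat, 'a) mpoly set)" for s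
    using that unfolding zero_set_I
    by (auto simp: fun_eq_iff coeff_poly_of_point X_vars_def restrict_def PiE_def
        extensional_def)
qed

section \<open>Local permutation polynomials\<close>

text \<open>Taking the coefficient of \<open>x ^ n\<close> commutes with setting \<open>y\<close> to
  \<open>b\<close>. This makes the coefficients in \<open>x\<close> accessible as univariate
  polynomials in \<open>y\<close>.\<close>

lemma poly_map_poly_coeff:
  "poly (map_poly (\<lambda>p. Polynomial.coeff p n) f) b = Polynomial.coeff (poly f [:b:]) n"
  by (induction f) (simp_all add: map_poly_pCons)

lemma poly_map_poly_eval: "poly (map_poly (\<lambda>p. poly p a) f) = eval2 f a"
proof
  show "poly (map_poly (\<lambda>p. poly p a) f) b = eval2 f a b" for b
    by (induction f) (simp_all add: map_poly_pCons eval2_def)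
qed

text \<open>The coefficient of \<open>y ^ (q - 1)\<close> is a polynomial in \<open>x\<close> of
  degree less than q. Its value at each \<open>a\<close> is the top coefficient of the permutation
  polynomial f(a,y), which is 0. The coefficient of \<open>x ^ (q - 1)\<close> is treated in the
  same way with f(x,b).\<close>

lemma coeff_local_perm_poly:
  fixes f :: "'a::{field, finite} poly poly"
  assumes q: "CARD('a) > 2" and f: "f \<in> local_perm_polys"
    and ij: "i > CARD('a) - 2 \<or> j > CARD('a) - 2"
  shows "Polynomial.coeff (Polynomial.coeff f j) i = 0"
proof -
  have deg: "Polynomial.degree (Polynomial.coeff f j) < CARD('a)" "Polynomial.degree f < CARD('a)"
    and bij: "bij (\<lambda>x. eval2 f x a)" "bij (\<lambda>x. eval2 f a x)" for a j
    using f by (auto simp: local_perm_polys_def)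
  have deg_map: "Polynomial.degree (map_poly g f) < CARD('a)" for g :: "'a poly \<Rightarrow> 'a"
    using map_poly_degree_leq deg(2) by (rule le_less_trans)
  have "Polynomial.coeff f (CARD('a) - 1) = 0"
  proof (rule poly_eqI_card)
    fix a
    have "Polynomial.coeff (map_poly (\<lambda>p. poly p a) f) (CARD('a) - 1) = 0"
      using deg_map bij(2)[of a]
      by (intro coeff_perm_poly[OF q]) (simp_all add: poly_map_poly_eval)
    then show "poly (Polynomial.coeff f (CARD('a) - 1)) a = poly 0 a"
      by (simp add: coeff_map_poly)
  qed (use deg in auto)
  then have y: "Polynomial.coeff f j = 0" if "j > CARD('a) - 2"
    using coeff_top_eq_0[OF deg(2)] that by blast
  have "map_poly (\<lambda>p. Polynomial.coeff p (CARD('a) - 1)) f = 0"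
  proof (rule poly_eqI_card)
    fix b
    \<comment> \<open>This bounds the degree of f(x,b): no coefficient of \<open>f\<close> contains
      a power \<open>x ^ n\<close> with n at least q.\<close>
    have "Polynomial.coeff (poly f [:b:]) n = 0" if "n \<ge> CARD('a)" for n
    proof -
      have "map_poly (\<lambda>p. Polynomial.coeff p n) f = 0"
        using coeff_eq_0[OF less_le_trans[OF deg(1) that]]
        by (intro poly_eqI) (simp add: coeff_map_poly)
      then show ?thesis
        by (simp flip: poly_map_poly_coeff)
    qed
    then have "Polynomial.coeff (poly f [:b:]) (CARD('a) - 1) = 0"
      using bij(1)[of b] by (intro coeff_perm_poly[OF q] degree_lessI) (auto simp: eval2_def[abs_def])
    then show "poly (map_poly (\<lambda>p. Polynomial.coeff p (CARD('a) - 1)) f) b = poly 0 b"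
      by (simp add: poly_map_poly_coeff)
  qed (use deg_map in simp_all)
  from arg_cong[OF this, of "\<lambda>p. Polynomial.coeff p j"]
  have "Polynomial.coeff (Polynomial.coeff f j) (CARD('a) - 1) = 0"
    by (simp add: coeff_map_poly)
  then have "Polynomial.coeff (Polynomial.coeff f j) i = 0" if "i > CARD('a) - 2"
    using coeff_top_eq_0[OF deg(1)] that by blast
  then show ?thesis
    using ij y by auto
qed

lemma coeff_poly2_of_point:
  fixes s :: "nat \<times> nat \<Rightarrow> 'a::{field, finite}"
  shows "Polynomial.coeff (Polynomial.coeff (poly2_of_point s) j) i =
    (if i \<le> CARD('a) - 2 \<and> j \<le> CARD('a) - 2 then s (i, j) else 0)"
proof -
  have "Polynomial.coeff (Polynomial.coeff (poly2_of_point s) j) i =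
    (\<Sum>k = 0..CARD('a) - 2. \<Sum>l = 0..CARD('a) - 2. if l = j then if k = i then s (k, l) else 0 else 0)"
    unfolding poly2_of_point_def coeff_sum by (intro sum.cong refl) auto
  then show ?thesis
    by (cases "j \<le> CARD('a) - 2") auto
qed

lemma eval2_poly2_of_point:
  fixes s :: "nat \<times> nat \<Rightarrow> 'a::{field, finite}"
  shows "eval2 (poly2_of_point s) x y =
    (\<Sum>i = 0..CARD('a) - 2. \<Sum>j = 0..CARD('a) - 2. s (i, j) * x ^ i * y ^ j)"
  by (simp add: poly2_of_point_def eval2_def poly_sum poly_monom)

text \<open>With f the polynomial of \<open>s\<close>, the argument of \<open>F\<close> evaluates to
  f(a,c) - f(b,c).\<close>

lemma eval_G_col:
  "eval_mpoly s (G_col a b c) = 0 \<longleftrightarrow> eval2 (poly2_of_point s) a c \<noteq> eval2 (poly2_of_point s) b c"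
  unfolding G_col_def eval_F_eq_0_iff eval2_poly2_of_point
  by (simp add: left_diff_distrib right_diff_distrib sum_subtractf mult_ac)

lemma eval_G_row:
  fixes s :: "nat \<times> nat \<Rightarrow> 'a::{field, finite}"
  shows "eval_mpoly s (G_row a b c) = 0 \<longleftrightarrow> eval2 (poly2_of_point s) c a \<noteq> eval2 (poly2_of_point s) c b"
proof -
  \<comment> \<open>In \<open>G_row\<close> the outer index is the exponent of \<open>y\<close>, so
    the two sums have to be exchanged.\<close>
  have "eval2 (poly2_of_point s) c x =
      (\<Sum>i = 0..CARD('a) - 2. \<Sum>j = 0..CARD('a) - 2. s (j, i) * c ^ j * x ^ i)" for x :: 'a
    unfolding eval2_poly2_of_point by (rule sum.swap)
  then show ?thesis
    unfolding G_row_def eval_F_eq_0_iff by (simp add: left_diff_distrib right_diff_distrib sum_subtractf mult_ac)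
qed

lemma
  shows finite_field_ideal_J:
      "finite_field_ideal (XX_vars TYPE('a)) (J_ideal :: (nat \<times> nat, 'a::{field, finite}) mpoly set)"
    and zero_set_J: "zero_set (XX_vars TYPE('a)) (J_ideal :: (nat \<times> nat, 'a) mpoly set) =
      {s \<in> XX_vars TYPE('a) \<rightarrow>\<^sub>E UNIV. \<forall>a.
        bij (\<lambda>x. eval2 (poly2_of_point s) x a) \<and> bij (\<lambda>x. eval2 (poly2_of_point s) a x)}"
proof -
  have fin: "finite (XX_vars TYPE('a))"
    by (simp add: XX_vars_def)
  have gens: "{G_row a b c | a b c :: 'a. a \<noteq> b} \<union> {G_col a b c | a b c. a \<noteq> b}
      \<subseteq> carrier (mpoly_ring (XX_vars TYPE('a)))"
    by (auto simp: G_row_def G_col_def XX_vars_def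
        intro!: F_carrier mpoly_carrier_sum mpoly_carrier_mult)
  show "finite_field_ideal (XX_vars TYPE('a)) (J_ideal :: (nat \<times> nat, 'a) mpoly set)"
    unfolding J_ideal_def Let_def by (rule finite_field_ideal_Idl[OF fin gens])
  have "(\<forall>p \<in> {G_row a b c | a b c :: 'a. a \<noteq> b} \<union> {G_col a b c | a b c. a \<noteq> b}.
        eval_mpoly s p = 0) \<longleftrightarrow>
      (\<forall>c a b. a \<noteq> b \<longrightarrow> eval_mpoly s (G_col a b c) = 0) \<and>
      (\<forall>c a b. a \<noteq> b \<longrightarrow> eval_mpoly s (G_row a b c) = 0)" for s
    by blast
  then show "zero_set (XX_vars TYPE('a)) (J_ideal :: (nat \<times> nat, 'a) mpoly set) =
      {s \<in> XX_vars TYPE('a) \<rightarrow>\<^sub>E UNIV. \<forall>a.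
        bij (\<lambda>x. eval2 (poly2_of_point s) x a) \<and> bij (\<lambda>x. eval2 (poly2_of_point s) a x)}"
    unfolding J_ideal_def Let_def zero_set_Idl[OF fin gens] bij_iff_distinct
    by (simp add: eval_G_row eval_G_col all_conj_distrib)
qed

lemma bij_betw_poly2_of_point:
  assumes "CARD('a::{field, finite}) > 2"
  shows "bij_betw poly2_of_point
    (zero_set (XX_vars TYPE('a)) (J_ideal :: (nat \<times> nat, 'a) mpoly set)) local_perm_polys"
proof -
  let ?coeffs = "\<lambda>f :: 'a poly poly.
    restrict (\<lambda>(i, j). Polynomial.coeff (Polynomial.coeff f j) i) (XX_vars TYPE('a))"
  have inverse: "poly2_of_point (?coeffs f) = f" if f: "f \<in> local_perm_polys" for f :: "'a poly poly"
  proof (intro poly_eqI)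
    fix i j
    show "Polynomial.coeff (Polynomial.coeff (poly2_of_point (?coeffs f)) j) i =
        Polynomial.coeff (Polynomial.coeff f j) i"
      using coeff_local_perm_poly[OF assms f, of i j]
      by (auto simp: coeff_poly2_of_point XX_vars_def)
  qed
  show ?thesis
  proof (rule bij_betwI[where g = ?coeffs])
    have "Polynomial.degree (Polynomial.coeff (poly2_of_point s) j) < CARD('a)"
      "Polynomial.degree (poly2_of_point s) < CARD('a)" for s :: "nat \<times> nat \<Rightarrow> 'a" and j
      using assms
      by (auto simp: coeff_poly2_of_point poly_eq_iff intro!: degree_lessI)
    then show "poly2_of_point \<in>
        zero_set (XX_vars TYPE('a)) (J_ideal :: (nat \<times> nat, 'a) mpoly set) \<rightarrow> local_perm_polys"
      by (auto simp: zero_set_J local_perm_polys_def)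
    show "?coeffs \<in> local_perm_polys \<rightarrow>
        zero_set (XX_vars TYPE('a)) (J_ideal :: (nat \<times> nat, 'a) mpoly set)"
      using inverse by (auto simp: zero_set_J local_perm_polys_def)
    show "?coeffs (poly2_of_point s) = s"
      if "s \<in> zero_set (XX_vars TYPE('a)) (J_ideal :: (nat \<times> nat, 'a) mpoly set)" for s
      using that unfolding zero_set_J
      by (auto simp: fun_eq_iff coeff_poly2_of_point XX_vars_def restrict_def PiE_def
          extensional_def)
  qed (rule inverse)
qed

section \<open>Nonempty zero sets and the theorem\<close>

lemma perm_polys_nonempty:
  assumes "CARD('a::{field, finite}) > 1"
  shows "perm_polys \<noteq> ({} :: 'a poly set)"
proof -
  have "[:0, 1:] \<in> (perm_polys :: 'a poly set)"
    using assms by (simp add: perm_polys_def bij_def inj_def surj_def)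
  then show ?thesis
    by blast
qed

lemma local_perm_polys_nonempty:
  assumes "CARD('a::{field, finite}) > 1"
  shows "local_perm_polys \<noteq> ({} :: 'a poly poly set)"
proof -
  \<comment> \<open>This is \<open>x + y\<close>; fixing either variable leaves a
    translation.\<close>
  have "[:[:0, 1:], 1:] \<in> (local_perm_polys :: 'a poly poly set)"
    using assms
    by (auto simp: local_perm_polys_def eval2_def coeff_pCons bij_iff_distinct split: nat.split)
  then show ?thesis
    by blast
qed

theorem lemma3p1:
  assumes "CARD('a::{field, finite}) > 3"
  shows
    "(zero_dimensional (X_vars TYPE('a)) (I_ideal :: (nat, 'a) mpoly set) \<and>
      radical_ideal (I_ideal :: (nat, 'a) mpoly set) (mpoly_ring (X_vars TYPE('a))) \<and>
      bij_betw poly_of_point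
        (zero_set (X_vars TYPE('a)) (I_ideal :: (nat, 'a) mpoly set)) perm_polys \<and>
      card (perm_polys :: 'a poly set) =
        card (zero_set (X_vars TYPE('a)) (I_ideal :: (nat, 'a) mpoly set)) \<and>
      card (zero_set (X_vars TYPE('a)) (I_ideal :: (nat, 'a) mpoly set)) =
        quot_dim (X_vars TYPE('a)) (I_ideal :: (nat, 'a) mpoly set)) \<and>
     (zero_dimensional (XX_vars TYPE('a)) (J_ideal :: (nat \<times> nat, 'a) mpoly set) \<and>
      radical_ideal (J_ideal :: (nat \<times> nat, 'a) mpoly set) (mpoly_ring (XX_vars TYPE('a))) \<and>
      bij_betw poly2_of_point
        (zero_set (XX_vars TYPE('a)) (J_ideal :: (nat \<times> nat, 'a) mpoly set)) local_perm_polys \<and>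
      card (local_perm_polys :: 'a poly poly set) =
        card (zero_set (XX_vars TYPE('a)) (J_ideal :: (nat \<times> nat, 'a) mpoly set)) \<and>
      card (zero_set (XX_vars TYPE('a)) (J_ideal :: (nat \<times> nat, 'a) mpoly set)) =
        quot_dim (XX_vars TYPE('a)) (J_ideal :: (nat \<times> nat, 'a) mpoly set))"
proof -
  have q: "CARD('a) > 2" "CARD('a) > 1"
    using assms by simp_all
  interpret I: finite_field_ideal "X_vars TYPE('a)" "I_ideal :: (nat, 'a) mpoly set"
    by (rule finite_field_ideal_I)
  interpret J: finite_field_ideal "XX_vars TYPE('a)" "J_ideal :: (nat \<times> nat, 'a) mpoly set"
    by (rule finite_field_ideal_J)
  note bij_I = bij_betw_poly_of_point[OF q(1)] and bij_J = bij_betw_poly2_of_point[OF q(1)]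
  \<comment> \<open>The zero sets are mapped onto nonempty sets; this supplies the assumption of
    \<open>quot_dim_eq\<close>.\<close>
  have "I.Z \<noteq> {}" "J.Z \<noteq> {}"
    using bij_betw_imp_surj_on[OF bij_I] perm_polys_nonempty[OF q(2)]
      bij_betw_imp_surj_on[OF bij_J] local_perm_polys_nonempty[OF q(2)]
    by auto
  then show ?thesis
    using I.zero_dim I.radical bij_I bij_betw_same_card[OF bij_I] I.quot_dim_eq
      J.zero_dim J.radical bij_J bij_betw_same_card[OF bij_J] J.quot_dim_eq
    by simp
qed

end
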